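(* Let $f:\mathbb{R}^n\to\mathbb{R}$ be twice continuously differentiable with $L$-Lipschitz gradient, let $\varphi_s:\mathbb{R}^{n_s}\to\mathbb{R}$ ($s=1,\dots,p$) be twice continuously differentiable and $\mu_s$-strongly convex ($\mu_s>0$), $\mu=\min_s\mu_s$, let $\alpha\in(0,\frac{\mu}{L})$, and let $x^*$ be a strict saddle point of $f$. Then the Jacobian $D\psi(x^* )$ of $\psi=\psi_p\circ\cdots\circ\psi_1$ at $x^*$ has at least one eigenvalue whose modulus is strictly greater than one.
   Context: $\|\nabla f(x)-\nabla f(y)\|\le L\|x-y\|$ for all $x,y$, $L>0$. The variable is partitioned as $x=(x(1),\dots,x(p))$, $x(s)\in\mathbb{R}^{n_s}$, $\sum_sn_s=n$; $U_s\in\mathbb{R}^{n\times n_s}$ is the $s$-th block-column of $I_n$ and $\nabla_sf(x)=U_s^T\nabla f(x)$. Strong convexity: $\varphi_s(y)\ge\varphi_s(x)+\langle\nabla\varphi_s(x),y-x\rangle+\frac{\mu_s}2\|y-x\|^2$. Define $\psi_s(x)=(I_n-U_sU_s^T)x+U_s[\nabla\varphi_s]^{-1}\big(\nabla\varphi_s(x(s))-\alpha\nabla_sf(x)\big)$. A strict saddle point is $x^*$ with $\nabla f(x^* )=0$ and $\lambda_{\min}(\nabla^2f(x^* ))<0$. *)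

theory Defs
  imports "HOL-Analysis.Analysis"
begin

text \<open>Gradient of a real-valued function on a Euclidean space (via the library notion GDERIV).\<close>
definition grad :: "('a::real_inner \<Rightarrow> real) \<Rightarrow> 'a \<Rightarrow> 'a" where
  "grad g x = (THE D. GDERIV g x :> D)"

text \<open>Hessian (Jacobian matrix of the gradient).\<close>
definition hessian :: "(real^'n \<Rightarrow> real) \<Rightarrow> real^'n \<Rightarrow> real^'n^'n" where
  "hessian g x = matrix (frechet_derivative (grad g) (at x))"

text \<open>Twice continuously differentiable on the whole space.\<close>
definition C2 :: "(real^'n \<Rightarrow> real) \<Rightarrow> bool" where
  "C2 g \<longleftrightarrow> (\<forall>x. g differentiable (at x)) \<and> (\<forall>x. grad g differentiable (at x))
            \<and> continuous_on UNIV (hessian g)"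

text \<open>Blocks: coordinate i belongs to block blk i. The projection U_s U_s^T and the
  coordinate subspace image of U_s (identified with R^{n_s}).\<close>
definition blkproj :: "('n \<Rightarrow> nat) \<Rightarrow> nat \<Rightarrow> real^'n \<Rightarrow> real^'n" where
  "blkproj blk s x = (\<chi> i. if blk i = s then x $ i else 0)"

definition blksub :: "('n \<Rightarrow> nat) \<Rightarrow> nat \<Rightarrow> (real^'n) set" where
  "blksub blk s = {v. \<forall>i. blk i \<noteq> s \<longrightarrow> v $ i = 0}"

text \<open>mu-strong convexity (first-order form) of a differentiable function on a set.\<close>
definition strongly_convex_grad_on :: "'a::real_inner set \<Rightarrow> real \<Rightarrow> ('a \<Rightarrow> real) \<Rightarrow> bool" where
  "strongly_convex_grad_on S m g \<longleftrightarrow>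
     (\<forall>x\<in>S. \<forall>y\<in>S. g y \<ge> g x + inner (grad g x) (y - x) + m / 2 * (norm (y - x))\<^sup>2)"

text \<open>The block map psi_s.\<close>
definition psi_blk :: "(real^'n \<Rightarrow> real) \<Rightarrow> (nat \<Rightarrow> real^'n \<Rightarrow> real) \<Rightarrow> ('n \<Rightarrow> nat) \<Rightarrow> real
    \<Rightarrow> nat \<Rightarrow> real^'n \<Rightarrow> real^'n" where
  "psi_blk f \<phi> blk \<alpha> s x =
     x - blkproj blk s x
     + inv_into (blksub blk s) (grad (\<phi> s))
         (grad (\<phi> s) (blkproj blk s x) - \<alpha> *\<^sub>R blkproj blk s (grad f x))"

text \<open>psi_comp k = psi_k o ... o psi_1.\<close>
primrec psi_comp :: "(real^'n \<Rightarrow> real) \<Rightarrow> (nat \<Rightarrow> real^'n \<Rightarrow> real) \<Rightarrow> ('n \<Rightarrow> nat) \<Rightarrow> real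
    \<Rightarrow> nat \<Rightarrow> real^'n \<Rightarrow> real^'n" where
  "psi_comp f \<phi> blk \<alpha> 0 = id"
| "psi_comp f \<phi> blk \<alpha> (Suc k) = psi_blk f \<phi> blk \<alpha> (Suc k) \<circ> psi_comp f \<phi> blk \<alpha> k"

text \<open>Real eigenvalues of a real matrix, and complex eigenvalues of a real matrix.\<close>
definition real_eigenvalue :: "real^'n^'n \<Rightarrow> real \<Rightarrow> bool" where
  "real_eigenvalue A l \<longleftrightarrow> (\<exists>v. v \<noteq> 0 \<and> A *v v = l *\<^sub>R v)"

definition complex_eigenvalue :: "real^'n^'n \<Rightarrow> complex \<Rightarrow> bool" where
  "complex_eigenvalue A l \<longleftrightarrow>
     (\<exists>v::complex^'n. v \<noteq> 0 \<and> (\<chi> i j. complex_of_real (A $ i $ j)) *v v = l *s v)"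

definition strict_saddle :: "(real^'n \<Rightarrow> real) \<Rightarrow> real^'n \<Rightarrow> bool" where
  "strict_saddle f x \<longleftrightarrow> grad f x = 0 \<and> (\<exists>l. real_eigenvalue (hessian f x) l \<and> l < 0)"

end

theory Submission
  imports Defs "Jordan_Normal_Form.Spectral_Radius"
begin

(* Let H be the Hessian of f at the saddle point, v an eigenvector of H with negative eigenvalue
   and q h = - <h, H h>. The linearisation of the block map psi_s replaces h by h - d with d in
   the s-th block and (Hessian of phi_s) d = alpha (H h)_s; strong convexity together with
   alpha L < mu makes q grow by at least (mu / alpha) |d|^2 at every block. Over a full sweep
   the corrections d control every block of H h, hence q h, so q (C h) >= (1 + delta) q h whenever
   q h >= 0, where C is the Jacobian of psi. Thus q (C^k v), and with it |C^k v|, grows exponentially. This is impossible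
   if all eigenvalues of C lie in the closed unit disc, because then the powers of C grow at most
   polynomially. *)

no_notation Matrix.vec_index (infixl "$" 100)
no_notation Matrix.scalar_prod (infix "\<bullet>" 70)

section \<open>Exponential growth of iterates forces an eigenvalue outside the unit disc\<close>

lemma tendsto_power_div_power_0:
  fixes r :: real
  assumes r: "r > 1"
  shows "(\<lambda>k. real k ^ m / r ^ k) \<longlonglongrightarrow> 0"
proof -
  define a where "a = ln r"
  have a: "a > 0" using r by (simp add: a_def)
  have lim: "filterlim (\<lambda>k. a * real k) at_top sequentially"
    by (rule filterlim_tendsto_pos_mult_at_top[OF tendsto_const a filterlim_real_sequentially])
  have "(\<lambda>k. (a * real k) ^ m / exp (a * real k)) \<longlonglongrightarrow> 0"
    using filterlim_compose[OF tendsto_power_div_exp_0 lim] by (simp add: o_def)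
  then have "(\<lambda>k. (1 / a ^ m) * ((a * real k) ^ m / exp (a * real k))) \<longlonglongrightarrow> (1 / a ^ m) * 0"
    by (intro tendsto_mult tendsto_const)
  moreover have "(1 / a ^ m) * ((a * real k) ^ m / exp (a * real k)) = real k ^ m / r ^ k" for k
  proof -
    have "exp (a * real k) = exp a ^ k" by (simp add: exp_of_nat_mult[symmetric] mult.commute)
    also have "\<dots> = r ^ k" using r by (simp add: a_def)
    finally have "exp (a * real k) = r ^ k" .
    then show ?thesis using a by (simp add: power_mult_distrib)
  qed
  ultimately show ?thesis by simp
qed

lemma sum_UNIV_bij_nat:
  fixes e :: "nat \<Rightarrow> 'n::finite"
  assumes "bij_betw e {0..<CARD('n)} UNIV"
  shows "(\<Sum>b\<in>UNIV. g b) = (\<Sum>l<CARD('n). g (e l))"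
  using sum.reindex_bij_betw[OF assms, of g] by (simp add: atLeast0LessThan)

text \<open>The spectral theory of the Jordan normal form library works with matrices indexed by
  natural numbers; \<open>e\<close> enumerates the index type.\<close>

definition mat_of_enum :: "(nat \<Rightarrow> 'n::finite) \<Rightarrow> real^'n^'n \<Rightarrow> complex Matrix.mat" where
  "mat_of_enum e A = mat CARD('n) CARD('n) (\<lambda>(i, j). complex_of_real (A $ e i $ e j))"

lemma mat_of_enum_carrier:
  fixes A :: "real^'n^'n"
  shows "mat_of_enum e A \<in> carrier_mat CARD('n) CARD('n)"
  by (simp add: mat_of_enum_def)

lemma funpow_mult_vector_eq_mat_of_enum_pow:
  fixes A :: "real^'n^'n" and e :: "nat \<Rightarrow> 'n"
  assumes e: "bij_betw e {0..<CARD('n)} UNIV"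
  shows "i < CARD('n) \<Longrightarrow> complex_of_real ((((*v) A ^^ k) w) $ e i)
     = (\<Sum>j<CARD('n). (mat_of_enum e A ^\<^sub>m k) $$ (i, j) * complex_of_real (w $ e j))"
proof (induction k arbitrary: w i)
  case 0
  have "(\<Sum>j<CARD('n). (mat_of_enum e A ^\<^sub>m 0) $$ (i, j) * complex_of_real (w $ e j))
      = (\<Sum>j<CARD('n). (if i = j then complex_of_real (w $ e j) else 0))"
    using 0 by (intro sum.cong) (auto simp: mat_of_enum_def)
  then show ?case using 0 by simp
next
  case (Suc k)
  let ?n = "CARD('n)" and ?M = "mat_of_enum e A"
  have dim: "dim_row (?M ^\<^sub>m k) = ?n" "dim_col (?M ^\<^sub>m k) = ?n"
    using pow_carrier_mat[OF mat_of_enum_carrier[of e A], of k] by (metis carrier_matD)+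
  have Av: "complex_of_real ((A *v w) $ e j) = (\<Sum>l<?n. ?M $$ (j, l) * complex_of_real (w $ e l))"
    if "j < ?n" for j
  proof -
    have "(A *v w) $ e j = (\<Sum>l<?n. A $ e j $ e l * w $ e l)"
      unfolding matrix_vector_mult_def by (simp add: sum_UNIV_bij_nat[OF e])
    then show ?thesis using that by (simp add: mat_of_enum_def)
  qed
  have "complex_of_real ((((*v) A ^^ Suc k) w) $ e i)
      = complex_of_real ((((*v) A ^^ k) (A *v w)) $ e i)"
    by (simp add: funpow_Suc_right del: funpow.simps)
  also have "\<dots> = (\<Sum>j<?n. (?M ^\<^sub>m k) $$ (i, j) * complex_of_real ((A *v w) $ e j))"
    using Suc by blast
  also have "\<dots> = (\<Sum>j<?n. (?M ^\<^sub>m k) $$ (i, j) * (\<Sum>l<?n. ?M $$ (j, l) * complex_of_real (w $ e l)))"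
    by (intro sum.cong refl) (simp add: Av)
  also have "\<dots> = (\<Sum>l<?n. (\<Sum>j<?n. (?M ^\<^sub>m k) $$ (i, j) * ?M $$ (j, l)) * complex_of_real (w $ e l))"
    unfolding sum_distrib_left sum_distrib_right mult.assoc by (rule sum.swap)
  also have "\<dots> = (\<Sum>l<?n. (?M ^\<^sub>m Suc k) $$ (i, l) * complex_of_real (w $ e l))"
  proof (intro sum.cong refl)
    fix l assume l: "l \<in> {..<?n}"
    have "(?M ^\<^sub>m Suc k) $$ (i, l) = (\<Sum>j<?n. (?M ^\<^sub>m k) $$ (i, j) * ?M $$ (j, l))"
      using Suc.prems l dim by (simp add: mat_of_enum_def scalar_prod_def atLeast0LessThan)
    then show "(\<Sum>j<?n. (?M ^\<^sub>m k) $$ (i, j) * ?M $$ (j, l)) * complex_of_real (w $ e l)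
        = (?M ^\<^sub>m Suc k) $$ (i, l) * complex_of_real (w $ e l)" by simp
  qed
  finally show ?case .
qed

lemma complex_eigenvalue_if_mem_spectrum:
  fixes A :: "real^'n^'n"
  assumes e: "bij_betw e {0..<CARD('n)} UNIV" and ev: "ev \<in> spectrum (mat_of_enum e A)"
  shows "complex_eigenvalue A ev"
proof -
  let ?n = "CARD('n)" and ?M = "mat_of_enum e A"
  obtain u where "eigenvector ?M u ev"
    using ev unfolding spectrum_def eigenvalue_def by auto
  then have uc: "u \<in> carrier_vec ?n" and u0: "u \<noteq> 0\<^sub>v ?n" and Mu: "?M *\<^sub>v u = ev \<cdot>\<^sub>v u"
    using mat_of_enum_carrier[of e A] unfolding eigenvector_def by auto
  define ei where "ei = inv_into {0..<?n} e"
  have ei1: "ei (e i) = i" if "i < ?n" for i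
    using e that unfolding ei_def bij_betw_def by (simp add: inv_into_f_f)
  have ei2: "e (ei a) = a" "ei a < ?n" for a
    using e unfolding ei_def bij_betw_def
    by (auto simp: f_inv_into_f) (metis UNIV_I atLeastLessThan_iff inv_into_into)
  define w :: "complex^'n" where "w = (\<chi> a. Matrix.vec_index u (ei a))"
  have "w \<noteq> 0"
  proof
    assume "w = 0"
    then have "Matrix.vec_index u i = 0" if "i < ?n" for i
      using that by (metis ei1 vec_lambda_beta w_def zero_index)
    then have "u = 0\<^sub>v ?n" using uc by (intro eq_vecI) auto
    with u0 show False by simp
  qed
  moreover have "(\<chi> i j. complex_of_real (A $ i $ j)) *v w = ev *s w"
  proof (rule Finite_Cartesian_Product.vec_eq_iff[THEN iffD2], intro allI)
    fix a
    have "((\<chi> i j. complex_of_real (A $ i $ j)) *v w) $ a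
        = (\<Sum>l<?n. complex_of_real (A $ a $ e l) * w $ e l)"
      by (simp add: matrix_vector_mult_def sum_UNIV_bij_nat[OF e])
    also have "\<dots> = (\<Sum>l<?n. ?M $$ (ei a, l) * Matrix.vec_index u l)"
      by (intro sum.cong refl) (simp add: mat_of_enum_def w_def ei1 ei2)
    also have "\<dots> = Matrix.vec_index (?M *\<^sub>v u) (ei a)"
      using ei2 uc by (simp add: mat_of_enum_def scalar_prod_def atLeast0LessThan)
    also have "\<dots> = ev * w $ a"
      using Mu ei2 uc by (simp add: w_def)
    finally show "((\<chi> i j. complex_of_real (A $ i $ j)) *v w) $ a = (ev *s w) $ a" by simp
  qed
  ultimately show ?thesis unfolding complex_eigenvalue_def by blast
qed

lemma funpow_mult_vector_polynomial_bound:
  fixes A :: "real^'n^'n" and v :: "real^'n"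
  assumes e: "bij_betw e {0..<CARD('n)} UNIV"
    and radius: "spectral_radius (mat_of_enum e A) \<le> 1"
  obtains c1 c2 where "\<And>k. norm (((*v) A ^^ k) v) \<le> c1 + c2 * real k ^ (CARD('n) - 1)"
proof -
  let ?n = "CARD('n)" and ?M = "mat_of_enum e A"
  obtain c1 c2 where nb: "\<And>k. norm_bound (?M ^\<^sub>m k) (c1 + c2 * real k ^ (?n - 1))"
    using spectral_radius_jnf_norm_bound_le_1_upper_triangular[OF mat_of_enum_carrier radius]
    by auto
  define V where "V = (\<Sum>j<?n. \<bar>v $ e j\<bar>)"
  have "norm (((*v) A ^^ k) v) \<le> real ?n * (V * (c1 + c2 * real k ^ (?n - 1)))" for k
  proof -
    let ?B = "c1 + c2 * real k ^ (?n - 1)"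
    have dim: "dim_row (?M ^\<^sub>m k) = ?n" "dim_col (?M ^\<^sub>m k) = ?n"
      using pow_carrier_mat[OF mat_of_enum_carrier[of e A], of k] by (metis carrier_matD)+
    have entry: "\<bar>(((*v) A ^^ k) v) $ e i\<bar> \<le> V * ?B" if i: "i < ?n" for i
    proof -
      have "\<bar>(((*v) A ^^ k) v) $ e i\<bar>
          = cmod (\<Sum>j<?n. (?M ^\<^sub>m k) $$ (i, j) * complex_of_real (v $ e j))"
        using funpow_mult_vector_eq_mat_of_enum_pow[OF e i] by (metis norm_of_real)
      also have "\<dots> \<le> (\<Sum>j<?n. cmod ((?M ^\<^sub>m k) $$ (i, j)) * \<bar>v $ e j\<bar>)"
        by (rule order_trans[OF norm_sum]) (simp add: norm_mult)
      also have "\<dots> \<le> (\<Sum>j<?n. ?B * \<bar>v $ e j\<bar>)"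
        using nb[of k] i dim unfolding norm_bound_def by (intro sum_mono mult_right_mono) auto
      also have "\<dots> = V * ?B" by (simp add: V_def sum_distrib_right mult.commute)
      finally show ?thesis .
    qed
    have "norm (((*v) A ^^ k) v) \<le> (\<Sum>a\<in>UNIV. \<bar>(((*v) A ^^ k) v) $ a\<bar>)"
      by (rule norm_le_l1_cart)
    also have "\<dots> = (\<Sum>i<?n. \<bar>(((*v) A ^^ k) v) $ e i\<bar>)"
      by (rule sum_UNIV_bij_nat[OF e])
    also have "\<dots> \<le> (\<Sum>i<?n. V * ?B)"
      by (intro sum_mono entry) auto
    finally show ?thesis by simp
  qed
  then show ?thesis
    by (intro that[of "real ?n * V * c1" "real ?n * V * c2"]) (simp add: algebra_simps)
qed

lemma complex_eigenvalue_gt_1_if_exponential_growth: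
  fixes A :: "real^'n^'n" and v :: "real^'n"
  assumes r: "r > 1" and c: "c > 0"
    and grow: "\<And>k. c * r ^ k \<le> norm (((*v) A ^^ k) v)"
  shows "\<exists>l. complex_eigenvalue A l \<and> cmod l > 1"
proof -
  obtain e where e: "bij_betw e {0..<CARD('n)} (UNIV::'n set)"
    using ex_bij_betw_nat_finite[of "UNIV::'n set"] by auto
  show ?thesis
  proof (cases "spectral_radius (mat_of_enum e A) > 1")
    case True
    obtain ev where ev: "ev \<in> spectrum (mat_of_enum e A)"
      and "norm ev = spectral_radius (mat_of_enum e A)"
      using spectral_radius_mem_max(1)[OF mat_of_enum_carrier] by fastforce
    moreover have "complex_eigenvalue A ev" by (rule complex_eigenvalue_if_mem_spectrum[OF e ev])
    ultimately show ?thesis using True by auto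
  next
    case False
    then obtain c1 c2 where bound: "\<And>k. norm (((*v) A ^^ k) v) \<le> c1 + c2 * real k ^ (CARD('n) - 1)"
      using funpow_mult_vector_polynomial_bound[OF e] by (metis linorder_not_less)
    have "(\<lambda>k. c1 * (real k ^ 0 / r ^ k) + c2 * (real k ^ (CARD('n) - 1) / r ^ k))
        \<longlonglongrightarrow> c1 * 0 + c2 * 0"
      by (intro tendsto_intros tendsto_power_div_power_0 r)
    then have "\<forall>\<^sub>F k in sequentially. c1 * (1 / r ^ k) + c2 * (real k ^ (CARD('n) - 1) / r ^ k) < c"
      using c by (simp add: order_tendsto_iff)
    then obtain k where k: "c1 * (1 / r ^ k) + c2 * (real k ^ (CARD('n) - 1) / r ^ k) < c"
      by (meson eventually_sequentially le_refl)
    moreover have "c1 * (1 / r ^ k) + c2 * (real k ^ (CARD('n) - 1) / r ^ k)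
        = (c1 + c2 * real k ^ (CARD('n) - 1)) / r ^ k"
      by (simp add: add_divide_distrib)
    moreover have "r ^ k > 0" using r by simp
    ultimately have "c1 + c2 * real k ^ (CARD('n) - 1) < c * r ^ k"
      by (simp add: divide_less_eq)
    with bound[of k] grow[of k] show ?thesis by simp
  qed
qed

section \<open>Gradients and second derivatives\<close>

lemma grad_eqI:
  fixes g :: "'a::real_inner \<Rightarrow> real"
  assumes "(g has_derivative (\<lambda>h. inner h D)) (at x)"
  shows "grad g x = D"
  unfolding grad_def
proof (rule the_equality)
  show "GDERIV g x :> D" using assms by (simp add: gderiv_def)
next
  fix D' assume "GDERIV g x :> D'"
  then have "(\<lambda>h. inner h D') = (\<lambda>h. inner h D)"
    using assms unfolding gderiv_def by (rule has_derivative_unique)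
  then show "D' = D" by (metis vector_eq_ldot)
qed

lemma has_derivative_grad:
  fixes g :: "'a::euclidean_space \<Rightarrow> real"
  assumes "g differentiable (at x)"
  shows "(g has_derivative (\<lambda>h. inner h (grad g x))) (at x)"
proof -
  obtain g' where g': "(g has_derivative g') (at x)"
    using assms by (auto simp: differentiable_def)
  then have "linear g'" by (rule has_derivative_linear)
  then have "g' = (\<lambda>h. inner h (adjoint g' 1))"
    by (simp add: adjoint_works)
  then show ?thesis using g' grad_eqI by metis
qed

lemma has_derivative_along_ray:
  fixes F :: "'a::real_normed_vector \<Rightarrow> 'b::real_normed_vector"
  assumes FG: "(F has_derivative G) (at x0)" and e: "e > 0"
  shows "\<exists>t>0. norm (F (x0 + t *\<^sub>R d) - F x0 - t *\<^sub>R G d) \<le> e * t * norm d"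
proof (cases "d = 0")
  case True
  have "G 0 = 0" using FG has_derivative_linear linear_0 by blast
  then show ?thesis using True by (intro exI[of _ 1]) auto
next
  case False
  have lin: "linear G" using FG has_derivative_linear by blast
  obtain \<delta> where \<delta>: "\<delta> > 0"
    and H: "\<And>y. norm (y - x0) < \<delta> \<Longrightarrow> norm (F y - F x0 - G (y - x0)) \<le> e * norm (y - x0)"
    using FG e unfolding has_derivative_at_alt by blast
  define t where "t = \<delta> / (2 * norm d)"
  have t: "t > 0" using \<delta> False by (simp add: t_def)
  have nt: "norm ((x0 + t *\<^sub>R d) - x0) = t * norm d" using t by simp
  also have "\<dots> < \<delta>" using \<delta> False by (simp add: t_def)
  finally have "norm (F (x0 + t *\<^sub>R d) - F x0 - G ((x0 + t *\<^sub>R d) - x0))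
      \<le> e * norm ((x0 + t *\<^sub>R d) - x0)"
    by (rule H)
  then have "norm (F (x0 + t *\<^sub>R d) - F x0 - t *\<^sub>R G d) \<le> e * (t * norm d)"
    using nt t by (simp add: linear_scale[OF lin])
  then show ?thesis using t by (intro exI[of _ t]) (auto simp: mult_ac)
qed

lemma derivative_inner_ge_if_increments_ge:
  fixes F :: "'a::real_inner \<Rightarrow> 'a"
  assumes FG: "(F has_derivative G) (at x0)"
    and low: "\<And>t. t > 0 \<Longrightarrow> m * t * (norm d)\<^sup>2 \<le> inner (F (x0 + t *\<^sub>R d) - F x0) d"
  shows "m * (norm d)\<^sup>2 \<le> inner (G d) d"
proof (rule field_le_epsilon)
  fix e :: real assume e: "e > 0"
  define e' where "e' = e / ((norm d)\<^sup>2 + 1)"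
  have nd1: "(norm d)\<^sup>2 + 1 > 0" using zero_le_power2[of "norm d"] by linarith
  then have e': "e' > 0" using e by (simp add: e'_def)
  obtain t where t: "t > 0" and tt: "norm (F (x0 + t *\<^sub>R d) - F x0 - t *\<^sub>R G d) \<le> e' * t * norm d"
    using has_derivative_along_ray[OF FG e'] by blast
  define r where "r = F (x0 + t *\<^sub>R d) - F x0 - t *\<^sub>R G d"
  have "inner (F (x0 + t *\<^sub>R d) - F x0) d = t * inner (G d) d + inner r d"
    by (simp add: r_def inner_diff_left)
  also have "inner r d \<le> norm r * norm d" by (rule order_trans[OF _ Cauchy_Schwarz_ineq2]) simp
  then have "inner r d \<le> e' * t * (norm d)\<^sup>2"
    using tt mult_right_mono[OF tt norm_ge_zero[of d]]
    by (simp add: r_def power2_eq_square mult_ac)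
  finally have "m * t * (norm d)\<^sup>2 \<le> t * inner (G d) d + e' * t * (norm d)\<^sup>2"
    using low[OF t] by simp
  then have "t * (m * (norm d)\<^sup>2) \<le> t * (inner (G d) d + e' * (norm d)\<^sup>2)"
    by (simp add: algebra_simps)
  then have "m * (norm d)\<^sup>2 \<le> inner (G d) d + e' * (norm d)\<^sup>2" using t by simp
  moreover have "e' * (norm d)\<^sup>2 \<le> e"
  proof -
    have "e' * (norm d)\<^sup>2 \<le> e' * ((norm d)\<^sup>2 + 1)" using e' by simp
    also have "\<dots> = e" using nd1 by (simp add: e'_def)
    finally show ?thesis .
  qed
  ultimately show "m * (norm d)\<^sup>2 \<le> inner (G d) d + e" by linarith
qed

lemma norm_derivative_le_if_Lipschitz:
  fixes F :: "'a::real_normed_vector \<Rightarrow> 'b::real_normed_vector"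
  assumes FG: "(F has_derivative G) (at x0)"
    and lip: "\<And>y. norm (F y - F x0) \<le> L * norm (y - x0)"
  shows "norm (G d) \<le> L * norm d"
proof (rule field_le_epsilon)
  fix e :: real assume e: "e > 0"
  define e' where "e' = e / (norm d + 1)"
  have nd1: "norm d + 1 > 0" using norm_ge_zero[of d] by linarith
  then have e': "e' > 0" using e by (simp add: e'_def)
  obtain t where t: "t > 0" and tt: "norm (F (x0 + t *\<^sub>R d) - F x0 - t *\<^sub>R G d) \<le> e' * t * norm d"
    using has_derivative_along_ray[OF FG e'] by blast
  have "t * norm (G d) = norm (t *\<^sub>R G d)" using t by simp
  also have "\<dots> \<le> norm (F (x0 + t *\<^sub>R d) - F x0) + norm (F (x0 + t *\<^sub>R d) - F x0 - t *\<^sub>R G d)"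
    using norm_triangle_ineq4[of "F (x0 + t *\<^sub>R d) - F x0" "F (x0 + t *\<^sub>R d) - F x0 - t *\<^sub>R G d"]
    by simp
  also have "\<dots> \<le> L * (t * norm d) + e' * t * norm d"
    using lip[of "x0 + t *\<^sub>R d"] tt t by simp
  finally have "t * norm (G d) \<le> t * (L * norm d + e' * norm d)" by (simp add: algebra_simps)
  then have "norm (G d) \<le> L * norm d + e' * norm d" using t by simp
  moreover have "e' * norm d \<le> e"
  proof -
    have "e' * norm d \<le> e' * (norm d + 1)" using e' by simp
    also have "\<dots> = e" using nd1 by (simp add: e'_def)
    finally show ?thesis .
  qed
  ultimately show "norm (G d) \<le> L * norm d + e" by linarith
qed

lemma has_real_derivative_along_line:
  fixes f :: "'a::euclidean_space \<Rightarrow> real"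
  assumes "f differentiable (at (a + s *\<^sub>R v))"
  shows "((\<lambda>s. f (a + s *\<^sub>R v)) has_real_derivative inner v (grad f (a + s *\<^sub>R v))) (at s)"
proof -
  have "((\<lambda>s. a + s *\<^sub>R v) has_derivative (\<lambda>s. s *\<^sub>R v)) (at s)"
    by (auto intro!: derivative_eq_intros)
  from has_derivative_compose[OF this has_derivative_grad[OF assms]]
  have "((\<lambda>s. f (a + s *\<^sub>R v)) has_derivative (\<lambda>x. inner (x *\<^sub>R v) (grad f (a + s *\<^sub>R v)))) (at s)" .
  moreover have "(\<lambda>x. inner (x *\<^sub>R v) (grad f (a + s *\<^sub>R v))) = (*) (inner v (grad f (a + s *\<^sub>R v)))"
    by (auto simp: mult.commute)
  ultimately show ?thesis by (simp add: has_field_derivative_def)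
qed

lemma second_difference_mean_value:
  fixes f :: "'a::euclidean_space \<Rightarrow> real"
  assumes diff: "\<And>x. f differentiable (at x)" and t: "t > 0"
  obtains \<xi> where "0 < \<xi>" and "\<xi> < t"
    and "f (x0 + t *\<^sub>R u + t *\<^sub>R v) - f (x0 + t *\<^sub>R u) - f (x0 + t *\<^sub>R v) + f x0
       = t * inner v (grad f (x0 + t *\<^sub>R u + \<xi> *\<^sub>R v) - grad f (x0 + \<xi> *\<^sub>R v))"
proof -
  define g where "g s = f (x0 + t *\<^sub>R u + s *\<^sub>R v) - f (x0 + s *\<^sub>R v)" for s
  define g' where
    "g' s = inner v (grad f (x0 + t *\<^sub>R u + s *\<^sub>R v)) - inner v (grad f (x0 + s *\<^sub>R v))" for s
  have "(g has_real_derivative g' s) (at s)" for s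
    unfolding g_def g'_def by (intro DERIV_diff has_real_derivative_along_line diff)
  then obtain \<xi> where "0 < \<xi>" "\<xi> < t" "g t - g 0 = (t - 0) * g' \<xi>"
    using MVT2[OF t, of g g'] by blast
  then show ?thesis using that by (simp add: g_def g'_def inner_diff_right algebra_simps)
qed

lemma second_difference_approx:
  fixes f :: "'a::euclidean_space \<Rightarrow> real"
  assumes diff: "\<And>x. f differentiable (at x)"
    and del: "\<And>y. norm (y - x0) < \<delta> \<Longrightarrow>
      norm (grad f y - grad f x0 - H (y - x0)) \<le> e * norm (y - x0)"
    and lin: "linear H" and t: "t > 0" and tu: "t * (norm u + norm v) < \<delta>" and e: "e \<ge> 0"
  shows "\<bar>f (x0 + t *\<^sub>R u + t *\<^sub>R v) - f (x0 + t *\<^sub>R u) - f (x0 + t *\<^sub>R v) + f x0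
            - t\<^sup>2 * inner (H u) v\<bar> \<le> 2 * e * (t * (norm u + norm v))\<^sup>2"
proof -
  obtain \<xi> where \<xi>: "0 < \<xi>" "\<xi> < t" and mv:
    "f (x0 + t *\<^sub>R u + t *\<^sub>R v) - f (x0 + t *\<^sub>R u) - f (x0 + t *\<^sub>R v) + f x0
       = t * inner v (grad f (x0 + t *\<^sub>R u + \<xi> *\<^sub>R v) - grad f (x0 + \<xi> *\<^sub>R v))"
    using second_difference_mean_value[OF diff t] by blast
  define y1 where "y1 = x0 + t *\<^sub>R u + \<xi> *\<^sub>R v"
  define y2 where "y2 = x0 + \<xi> *\<^sub>R v"
  define C where "C = t * (norm u + norm v)"
  have tv: "t * norm v \<le> C" using t by (simp add: C_def algebra_simps)
  have "norm (y1 - x0) \<le> t * norm u + \<xi> * norm v"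
    using norm_triangle_ineq[of "t *\<^sub>R u" "\<xi> *\<^sub>R v"] t \<xi> by (simp add: y1_def)
  also have "\<dots> \<le> C" using \<xi> by (simp add: C_def algebra_simps mult_right_mono)
  finally have n1: "norm (y1 - x0) \<le> C" .
  have n2: "norm (y2 - x0) \<le> C"
    using \<xi> tv mult_right_mono[of \<xi> t "norm v"] by (simp add: y2_def)
  define e1 where "e1 = grad f y1 - grad f x0 - H (y1 - x0)"
  define e2 where "e2 = grad f y2 - grad f x0 - H (y2 - x0)"
  have "C < \<delta>" using tu by (simp add: C_def)
  then have ne: "norm e1 \<le> e * C" "norm e2 \<le> e * C"
    unfolding e1_def e2_def using del[of y1] del[of y2] n1 n2 e
    by (meson le_less_trans mult_left_mono order_trans)+
  have "grad f y1 - grad f y2 = H (y1 - y2) + (e1 - e2)"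
    by (simp add: e1_def e2_def linear_diff[OF lin])
  also have "y1 - y2 = t *\<^sub>R u" by (simp add: y1_def y2_def)
  finally have gd: "grad f y1 - grad f y2 = t *\<^sub>R H u + (e1 - e2)"
    by (simp add: linear_scale[OF lin])
  have "t * inner v (grad f y1 - grad f y2) - t\<^sup>2 * inner (H u) v = t * inner v (e1 - e2)"
    unfolding gd by (simp add: inner_add_right inner_commute[of "H u" v] power2_eq_square algebra_simps)
  with mv[folded y1_def y2_def] have "\<bar>f (x0 + t *\<^sub>R u + t *\<^sub>R v) - f (x0 + t *\<^sub>R u)
      - f (x0 + t *\<^sub>R v) + f x0 - t\<^sup>2 * inner (H u) v\<bar> = t * \<bar>inner v (e1 - e2)\<bar>"
    using t by (simp add: abs_mult)
  also have "\<dots> \<le> t * (norm v * (norm e1 + norm e2))"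
    using Cauchy_Schwarz_ineq2[of v "e1 - e2"] norm_triangle_ineq4[of e1 e2] t
    by (smt (verit) mult_left_mono norm_ge_zero)
  also have "\<dots> \<le> (t * norm v) * (2 * (e * C))"
    using ne t by (simp add: mult_left_mono mult.assoc)
  also have "\<dots> \<le> C * (2 * (e * C))"
    using tv e t by (intro mult_right_mono) (auto simp: C_def)
  also have "\<dots> = 2 * e * C\<^sup>2" by (simp add: power2_eq_square mult_ac)
  finally show ?thesis unfolding C_def .
qed

lemma derivative_grad_symmetric:
  fixes f :: "'a::euclidean_space \<Rightarrow> real"
  assumes diff: "\<And>x. f differentiable (at x)"
    and H: "(grad f has_derivative H) (at x0)"
  shows "inner u (H v) = inner (H u) v"
proof -
  have lin: "linear H" using H by (rule has_derivative_linear)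
  define N where "N = norm u + norm v"
  have N: "N \<ge> 0" by (simp add: N_def)
  have bound: "\<bar>inner (H u) v - inner (H v) u\<bar> \<le> 4 * e * N\<^sup>2" if e: "e > 0" for e
  proof -
    obtain \<delta> where \<delta>: "\<delta> > 0" and del: "\<And>y. norm (y - x0) < \<delta> \<Longrightarrow>
        norm (grad f y - grad f x0 - H (y - x0)) \<le> e * norm (y - x0)"
      using H e unfolding has_derivative_at_alt by blast
    define t where "t = \<delta> / (2 * (N + 1))"
    have t: "t > 0" unfolding t_def using \<delta> N by (intro divide_pos_pos) auto
    have "t * N < t * (N + 1)" using t by simp
    also have "\<dots> = \<delta> / 2" using N unfolding t_def by (simp add: field_simps)
    finally have "t * N < \<delta>" using \<delta> by simp
    then have tu: "t * (norm u + norm v) < \<delta>" and tv: "t * (norm v + norm u) < \<delta>"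
      by (simp_all add: N_def add.commute)
    have "\<bar>f (x0 + t *\<^sub>R u + t *\<^sub>R v) - f (x0 + t *\<^sub>R u) - f (x0 + t *\<^sub>R v) + f x0
        - t\<^sup>2 * inner (H u) v\<bar> \<le> 2 * e * (t * N)\<^sup>2"
      using second_difference_approx[OF diff del lin t tu] e by (simp add: N_def)
    moreover have "\<bar>f (x0 + t *\<^sub>R u + t *\<^sub>R v) - f (x0 + t *\<^sub>R v) - f (x0 + t *\<^sub>R u) + f x0
        - t\<^sup>2 * inner (H v) u\<bar> \<le> 2 * e * (t * N)\<^sup>2"
      using second_difference_approx[OF diff del lin t tv] e
      by (simp add: N_def add.commute[of "norm v"] add.commute[of "t *\<^sub>R v"] add.assoc)
    ultimately have bound_t: "\<bar>t\<^sup>2 * inner (H u) v - t\<^sup>2 * inner (H v) u\<bar> \<le> 4 * e * (t * N)\<^sup>2"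
      unfolding abs_le_iff by linarith
    have "t\<^sup>2 * \<bar>inner (H u) v - inner (H v) u\<bar> = \<bar>t\<^sup>2 * inner (H u) v - t\<^sup>2 * inner (H v) u\<bar>"
      by (metis abs_mult abs_of_nonneg zero_le_power2 right_diff_distrib)
    also have "\<dots> \<le> t\<^sup>2 * (4 * e * N\<^sup>2)"
      using bound_t by (simp add: power_mult_distrib mult_ac)
    finally have "t\<^sup>2 * \<bar>inner (H u) v - inner (H v) u\<bar> \<le> t\<^sup>2 * (4 * e * N\<^sup>2)" .
    then show ?thesis using t by simp
  qed
  have denom: "4 * N\<^sup>2 + 1 > 0" by (auto intro: add_nonneg_pos)
  have "\<bar>inner (H u) v - inner (H v) u\<bar> \<le> 0"
  proof (rule field_le_epsilon)
    fix \<epsilon> :: real assume \<epsilon>: "\<epsilon> > 0"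
    have "\<epsilon> / (4 * N\<^sup>2 + 1) > 0" using \<epsilon> denom by simp
    then have "\<bar>inner (H u) v - inner (H v) u\<bar> \<le> 4 * (\<epsilon> / (4 * N\<^sup>2 + 1)) * N\<^sup>2"
      by (rule bound)
    also have "\<dots> \<le> \<epsilon>" using \<epsilon> denom by (simp add: field_simps)
    finally show "\<bar>inner (H u) v - inner (H v) u\<bar> \<le> 0 + \<epsilon>" by simp
  qed
  then show ?thesis by (simp add: inner_commute[of u])
qed

section \<open>Block projections\<close>

lemma blkproj_component [simp]: "blkproj blk s x $ i = (if blk i = s then x $ i else 0)"
  by (simp add: blkproj_def)

lemma linear_blkproj: "linear (blkproj blk s)"
  by (rule linearI) (auto simp: Finite_Cartesian_Product.vec_eq_iff)

lemma bounded_linear_blkproj: "bounded_linear (blkproj blk s)"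
  using linear_blkproj linear_conv_bounded_linear by blast

lemma has_derivative_blkproj: "(blkproj blk s has_derivative blkproj blk s) F"
  by (rule bounded_linear_imp_has_derivative[OF bounded_linear_blkproj])

lemma blkproj_add: "blkproj blk s (x + y) = blkproj blk s x + blkproj blk s y"
  by (rule linear_add[OF linear_blkproj])

lemma blkproj_diff: "blkproj blk s (x - y) = blkproj blk s x - blkproj blk s y"
  by (rule linear_diff[OF linear_blkproj])

lemma blkproj_zero [simp]: "blkproj blk s 0 = 0"
  by (rule linear_0[OF linear_blkproj])

lemma blkproj_idem [simp]: "blkproj blk s (blkproj blk s x) = blkproj blk s x"
  by (auto simp: Finite_Cartesian_Product.vec_eq_iff)

lemma norm_blkproj_le: "norm (blkproj blk s x) \<le> norm x"
  by (rule norm_le_componentwise_cart) auto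

lemma blkproj_in_blksub: "blkproj blk s x \<in> blksub blk s"
  by (simp add: blksub_def)

lemma blkproj_blksub: "d \<in> blksub blk s \<Longrightarrow> blkproj blk s d = d"
  by (auto simp: blksub_def Finite_Cartesian_Product.vec_eq_iff)

lemma blksub_iff_blkproj_eq: "d \<in> blksub blk s \<longleftrightarrow> blkproj blk s d = d"
  by (metis blkproj_blksub blkproj_in_blksub)

lemma subspace_blksub: "Real_Vector_Spaces.subspace (blksub blk s)"
  by (auto simp: Real_Vector_Spaces.subspace_def blksub_def)

lemma inner_blkproj_left: "inner (blkproj blk s x) y = inner x (blkproj blk s y)"
  by (simp add: inner_vec_def) (auto intro: sum.cong)

lemma inner_blksub_blkproj: "d \<in> blksub blk s \<Longrightarrow> inner d (blkproj blk s w) = inner d w"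
  by (metis blkproj_blksub inner_blkproj_left)

lemma sum_blkproj:
  assumes "\<And>i. blk i \<in> {1..p}"
  shows "(\<Sum>s\<in>{1..p}. blkproj blk s x) = x"
proof (rule Finite_Cartesian_Product.vec_eq_iff[THEN iffD2], intro allI)
  fix i
  have "(\<Sum>s\<in>{1..p}. blkproj blk s x) $ i = (\<Sum>s\<in>{1..p}. (if blk i = s then x $ i else 0))"
    by (simp add: sum_component)
  also have "\<dots> = x $ i" using assms[of i] by (simp add: sum.delta)
  finally show "(\<Sum>s\<in>{1..p}. blkproj blk s x) $ i = x $ i" .
qed

lemma grad_eq_blkproj_grad_blkproj:
  fixes \<phi> :: "real^'n \<Rightarrow> real"
  assumes inv: "\<And>x. \<phi> x = \<phi> (blkproj blk s x)" and diff: "\<And>x. \<phi> differentiable (at x)"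
  shows "grad \<phi> x = blkproj blk s (grad \<phi> (blkproj blk s x))"
proof (rule grad_eqI)
  have "((\<phi> \<circ> blkproj blk s) has_derivative
      ((\<lambda>h. inner h (grad \<phi> (blkproj blk s x))) \<circ> blkproj blk s)) (at x)"
    by (rule diff_chain_at[OF has_derivative_blkproj has_derivative_grad[OF diff]])
  moreover have "\<phi> \<circ> blkproj blk s = \<phi>" using inv by (auto simp: o_def)
  moreover have "(\<lambda>h. inner h (grad \<phi> (blkproj blk s x))) \<circ> blkproj blk s
      = (\<lambda>h. inner h (blkproj blk s (grad \<phi> (blkproj blk s x))))"
    by (auto simp: o_def inner_blkproj_left)
  ultimately show "(\<phi> has_derivative (\<lambda>h. inner h (blkproj blk s (grad \<phi> (blkproj blk s x))))) (at x)"
    by simp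
qed

section \<open>Strong convexity\<close>

lemma strongly_convex_grad_on_mono:
  assumes "strongly_convex_grad_on S m g" and "m' \<le> m"
  shows "strongly_convex_grad_on S m' g"
proof -
  have "m' / 2 * (norm (y - x))\<^sup>2 \<le> m / 2 * (norm (y - x))\<^sup>2" for x y :: 'a
    using assms(2) by (intro mult_right_mono) auto
  then show ?thesis using assms(1) unfolding strongly_convex_grad_on_def by (meson add_left_mono order_trans)
qed

lemma strongly_convex_grad_on_imp_monotone:
  assumes sc: "strongly_convex_grad_on S m g" and x: "x \<in> S" and y: "y \<in> S"
  shows "m * (norm (x - y))\<^sup>2 \<le> inner (grad g x - grad g y) (x - y)"
proof -
  have 1: "g y \<ge> g x + inner (grad g x) (y - x) + m / 2 * (norm (x - y))\<^sup>2"
    using sc x y unfolding strongly_convex_grad_on_def by (metis norm_minus_commute)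
  have 2: "g x \<ge> g y + inner (grad g y) (x - y) + m / 2 * (norm (x - y))\<^sup>2"
    using sc x y unfolding strongly_convex_grad_on_def by blast
  have "inner (grad g x) (y - x) = - inner (grad g x) (x - y)"
    by (simp add: inner_diff_right)
  then show ?thesis using 1 2 by (simp add: inner_diff_left)
qed

section \<open>Linearisation of a block step at a critical point\<close>

lemma has_derivative_inv_at_image:
  fixes F :: "'a::euclidean_space \<Rightarrow> 'a"
  assumes cont: "continuous_on UNIV F" and inj: "inj F"
    and der: "(F has_derivative F') (at x)" and inj': "inj F'"
  obtains F'' where "linear F''" "\<And>y. F'' (F' y) = y" "\<And>y. F' (F'' y) = y"
    and "(inv_into UNIV F has_derivative F'') (at (F x))" and "F x \<in> interior (range F)"
proof -
  have "linear F'" using der by (rule has_derivative_linear)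
  then obtain F'' where F'': "linear F''" "\<And>y. F'' (F' y) = y" "\<And>y. F' (F'' y) = y"
    using linear_injective_isomorphism[OF _ inj'] by auto
  have id: "F' \<circ> F'' = id" using F''(3) by auto
  have "(inv_into UNIV F has_derivative F'') (at (F x))"
    by (rule has_derivative_inverse_strong[OF open_UNIV UNIV_I cont _ der id]) (simp add: inj)
  moreover have "F x \<in> interior (range F)"
    using F''(1) linear_conv_bounded_linear
    by (intro sussmann_open_mapping[OF open_UNIV cont UNIV_I der _ id subset_refl]) auto
  ultimately show ?thesis using F'' that by blast
qed

locale block_potential =
  fixes blk :: "'n::finite \<Rightarrow> nat" and s :: nat and \<phi> :: "nat \<Rightarrow> real^'n \<Rightarrow> real" and m :: real
  assumes phi_block: "\<And>x. \<phi> s x = \<phi> s (blkproj blk s x)"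
    and phi_differentiable: "\<And>x. \<phi> s differentiable (at x)"
    and grad_phi_differentiable: "\<And>x. grad (\<phi> s) differentiable (at x)"
    and phi_strongly_convex: "strongly_convex_grad_on (blksub blk s) m (\<phi> s)"
    and m_pos: "m > 0"
begin

lemma grad_phi_eq: "grad (\<phi> s) x = blkproj blk s (grad (\<phi> s) (blkproj blk s x))"
  by (rule grad_eq_blkproj_grad_blkproj[OF phi_block phi_differentiable])

lemma grad_phi_in_blksub: "grad (\<phi> s) x \<in> blksub blk s"
  by (subst grad_phi_eq) (rule blkproj_in_blksub)

lemma blkproj_grad_phi [simp]: "blkproj blk s (grad (\<phi> s) x) = grad (\<phi> s) x"
  using grad_phi_in_blksub by (rule blkproj_blksub)

lemma grad_phi_blkproj [simp]: "grad (\<phi> s) (blkproj blk s x) = grad (\<phi> s) x"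
  using grad_phi_eq[of x] by simp

lemma inj_on_grad_phi: "inj_on (grad (\<phi> s)) (blksub blk s)"
proof (rule inj_onI)
  fix x y assume "x \<in> blksub blk s" "y \<in> blksub blk s" "grad (\<phi> s) x = grad (\<phi> s) y"
  then have "m * (norm (x - y))\<^sup>2 \<le> 0"
    using strongly_convex_grad_on_imp_monotone[OF phi_strongly_convex] by fastforce
  then show "x = y" using m_pos by (simp add: mult_le_0_iff)
qed

lemma has_derivative_grad_phi:
  "(grad (\<phi> s) has_derivative frechet_derivative (grad (\<phi> s)) (at x)) (at x)"
  using grad_phi_differentiable frechet_derivative_works by blast

text \<open>Extending the gradient of \<open>\<phi> s\<close> by the identity on the other blocks gives a global
  homeomorphism, whose inverse provides a differentiable inverse of the gradient on the block.\<close>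

definition grad_ext :: "real^'n \<Rightarrow> real^'n" where
  "grad_ext x = grad (\<phi> s) x + (x - blkproj blk s x)"

lemma blkproj_grad_ext: "blkproj blk s (grad_ext x) = grad (\<phi> s) x"
  by (simp add: grad_ext_def blkproj_add blkproj_diff)

lemma has_derivative_grad_ext:
  assumes "(grad (\<phi> s) has_derivative G) (at x)"
  shows "(grad_ext has_derivative (\<lambda>h. G h + (h - blkproj blk s h))) (at x)"
  unfolding grad_ext_def[abs_def]
  by (intro has_derivative_add assms has_derivative_diff has_derivative_ident has_derivative_blkproj)

lemma continuous_on_grad_ext: "continuous_on UNIV grad_ext"
  using has_derivative_continuous[OF has_derivative_grad_ext[OF has_derivative_grad_phi]]
  by (simp add: continuous_at_imp_continuous_on)

lemma inj_grad_ext: "inj grad_ext"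
proof (rule injI)
  fix x y assume eq: "grad_ext x = grad_ext y"
  then have grad_eq: "grad (\<phi> s) x = grad (\<phi> s) y" by (metis blkproj_grad_ext)
  then have "x - blkproj blk s x = y - blkproj blk s y" using eq by (simp add: grad_ext_def)
  moreover have "blkproj blk s x = blkproj blk s y"
  proof (rule inj_onD[OF inj_on_grad_phi])
    show "grad (\<phi> s) (blkproj blk s x) = grad (\<phi> s) (blkproj blk s y)" using grad_eq by simp
  qed (rule blkproj_in_blksub)+
  ultimately show "x = y" by (metis diff_add_cancel)
qed

lemma inv_into_grad_phi_eq_inv_grad_ext:
  assumes "y \<in> range grad_ext" and "y \<in> blksub blk s"
  shows "inv_into (blksub blk s) (grad (\<phi> s)) y = inv_into UNIV grad_ext y"
proof -
  obtain x where x: "y = grad_ext x" using assms(1) by blast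
  have "grad (\<phi> s) x = blkproj blk s y" using x by (simp add: blkproj_grad_ext)
  also have "\<dots> = y" using assms(2) by (rule blkproj_blksub)
  finally have grad_x: "grad (\<phi> s) x = y" .
  then have "x - blkproj blk s x = 0" using x by (simp add: grad_ext_def)
  then have "x \<in> blksub blk s" by (simp add: blksub_iff_blkproj_eq)
  then have "inv_into (blksub blk s) (grad (\<phi> s)) y = x"
    using grad_x inj_on_grad_phi by (auto intro: inv_into_f_eq)
  also have "x = inv_into UNIV grad_ext y" using x inj_grad_ext by (simp add: inv_f_f)
  finally show ?thesis .
qed

context
  fixes x0 G
  assumes x0: "x0 \<in> blksub blk s" and G: "(grad (\<phi> s) has_derivative G) (at x0)"
begin

lemma blkproj_deriv_grad_phi: "blkproj blk s (G h) = G h"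
proof -
  have "((blkproj blk s \<circ> grad (\<phi> s)) has_derivative (blkproj blk s \<circ> G)) (at x0)"
    by (rule diff_chain_at[OF G has_derivative_blkproj])
  moreover have "blkproj blk s \<circ> grad (\<phi> s) = grad (\<phi> s)" by (auto simp: o_def)
  ultimately have "(grad (\<phi> s) has_derivative (blkproj blk s \<circ> G)) (at x0)" by simp
  from has_derivative_unique[OF this G] have "blkproj blk s \<circ> G = G" .
  then show ?thesis by (metis comp_apply)
qed

lemma deriv_grad_phi_coercive:
  assumes d: "d \<in> blksub blk s"
  shows "m * (norm d)\<^sup>2 \<le> inner (G d) d"
proof (rule derivative_inner_ge_if_increments_ge[OF G])
  fix t :: real assume t: "t > 0"
  have "x0 + t *\<^sub>R d \<in> blksub blk s"
    by (intro subspace_add[OF subspace_blksub] subspace_mul[OF subspace_blksub] x0 d)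
  from strongly_convex_grad_on_imp_monotone[OF phi_strongly_convex this x0]
  have "m * (norm (t *\<^sub>R d))\<^sup>2 \<le> inner (grad (\<phi> s) (x0 + t *\<^sub>R d) - grad (\<phi> s) x0) (t *\<^sub>R d)"
    by simp
  then have "t * (m * t * (norm d)\<^sup>2) \<le> t * inner (grad (\<phi> s) (x0 + t *\<^sub>R d) - grad (\<phi> s) x0) d"
    using t by (simp add: power2_eq_square algebra_simps)
  then show "m * t * (norm d)\<^sup>2 \<le> inner (grad (\<phi> s) (x0 + t *\<^sub>R d) - grad (\<phi> s) x0) d"
    using t by simp
qed

lemma inj_deriv_grad_ext: "inj (\<lambda>h. G h + (h - blkproj blk s h))"
proof -
  have kernel: "h = 0" if h: "G h + (h - blkproj blk s h) = 0" for h
  proof -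
    have "G h = blkproj blk s (G h + (h - blkproj blk s h))"
      by (simp add: blkproj_add blkproj_diff blkproj_deriv_grad_phi)
    then have "G h = 0" using h by simp
    then have "h \<in> blksub blk s" using h by (simp add: blksub_iff_blkproj_eq)
    then have "m * (norm h)\<^sup>2 \<le> 0"
      using deriv_grad_phi_coercive[of h] \<open>G h = 0\<close> by simp
    then show "h = 0" using m_pos by (simp add: mult_le_0_iff)
  qed
  have "linear (\<lambda>h. G h + (h - blkproj blk s h))"
    using has_derivative_grad_ext[OF G] by (rule has_derivative_linear)
  from linear_injective_0[OF this] kernel show ?thesis by blast
qed

lemma inverse_deriv_grad_ext_blksub:
  assumes Ginv: "\<And>y. G (Ginv y) + (Ginv y - blkproj blk s (Ginv y)) = y"
    and z: "z \<in> blksub blk s"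
  shows "Ginv z \<in> blksub blk s" and "G (Ginv z) = z"
proof -
  have "blkproj blk s (G (Ginv z) + (Ginv z - blkproj blk s (Ginv z))) = G (Ginv z)"
    by (simp add: blkproj_add blkproj_diff blkproj_deriv_grad_phi)
  then show "G (Ginv z) = z" using Ginv[of z] blkproj_blksub[OF z] by simp
  then show "Ginv z \<in> blksub blk s" using Ginv[of z] by (simp add: blksub_iff_blkproj_eq)
qed

end

definition psi_arg :: "(real^'n \<Rightarrow> real) \<Rightarrow> real \<Rightarrow> real^'n \<Rightarrow> real^'n" where
  "psi_arg f \<alpha> x = grad (\<phi> s) (blkproj blk s x) - \<alpha> *\<^sub>R blkproj blk s (grad f x)"

lemma psi_arg_in_blksub: "psi_arg f \<alpha> x \<in> blksub blk s"
  unfolding psi_arg_def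
  by (intro subspace_diff[OF subspace_blksub] subspace_mul[OF subspace_blksub]
      grad_phi_in_blksub blkproj_in_blksub)

lemma has_derivative_psi_arg:
  assumes Hf: "(grad f has_derivative Hf) (at x)"
  shows "(psi_arg f \<alpha> has_derivative (\<lambda>h. frechet_derivative (grad (\<phi> s)) (at (blkproj blk s x))
      (blkproj blk s h) - \<alpha> *\<^sub>R blkproj blk s (Hf h))) (at x)"
proof -
  have "((grad (\<phi> s) \<circ> blkproj blk s) has_derivative
      (frechet_derivative (grad (\<phi> s)) (at (blkproj blk s x)) \<circ> blkproj blk s)) (at x)"
    by (rule diff_chain_at[OF has_derivative_blkproj has_derivative_grad_phi])
  moreover have "((blkproj blk s \<circ> grad f) has_derivative (blkproj blk s \<circ> Hf)) (at x)"
    by (rule diff_chain_at[OF Hf has_derivative_blkproj])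
  ultimately show ?thesis unfolding psi_arg_def[abs_def] o_def
    by (intro has_derivative_diff has_derivative_scaleR_right)
qed

lemma eventually_psi_blk_eq_inv_grad_ext:
  assumes "isCont (psi_arg f \<alpha>) x" and "psi_arg f \<alpha> x \<in> interior (range grad_ext)"
  shows "\<forall>\<^sub>F y in at x.
    y - blkproj blk s y + inv_into UNIV grad_ext (psi_arg f \<alpha> y) = psi_blk f \<phi> blk \<alpha> s y"
proof -
  have "\<forall>\<^sub>F y in at x. psi_arg f \<alpha> y \<in> interior (range grad_ext)"
    by (rule topological_tendstoD[OF assms(1)[unfolded continuous_at] open_interior assms(2)])
  then show ?thesis
  proof (rule eventually_mono)
    fix y assume "psi_arg f \<alpha> y \<in> interior (range grad_ext)"
    then have "psi_arg f \<alpha> y \<in> range grad_ext" using interior_subset by blast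
    then show "y - blkproj blk s y + inv_into UNIV grad_ext (psi_arg f \<alpha> y) = psi_blk f \<phi> blk \<alpha> s y"
      using inv_into_grad_phi_eq_inv_grad_ext[OF _ psi_arg_in_blksub]
      by (simp add: psi_blk_def psi_arg_def)
  qed
qed

lemma psi_blk_fixed_point:
  assumes "grad f xs = 0"
  shows "psi_blk f \<phi> blk \<alpha> s xs = xs"
proof -
  have "inv_into (blksub blk s) (grad (\<phi> s)) (grad (\<phi> s) (blkproj blk s xs)) = blkproj blk s xs"
    using inj_on_grad_phi blkproj_in_blksub by (rule inv_into_f_f)
  then show ?thesis using assms by (simp add: psi_blk_def)
qed

lemma psi_blk_linearisation:
  assumes Hf: "(grad f has_derivative Hf) (at xs)" and gf0: "grad f xs = 0"
  obtains D where "(psi_blk f \<phi> blk \<alpha> s has_derivative D) (at xs)"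
    and "\<And>h. \<exists>d\<in>blksub blk s. D h = h - d \<and>
      frechet_derivative (grad (\<phi> s)) (at (blkproj blk s xs)) d = \<alpha> *\<^sub>R blkproj blk s (Hf h)"
proof -
  let ?P = "blkproj blk s"
  define x0 where "x0 = ?P xs"
  define G where "G = frechet_derivative (grad (\<phi> s)) (at x0)"
  have x0: "x0 \<in> blksub blk s" by (simp add: x0_def blkproj_in_blksub)
  have G: "(grad (\<phi> s) has_derivative G) (at x0)" unfolding G_def by (rule has_derivative_grad_phi)
  obtain Ginv where Ginv: "linear Ginv" "\<And>y. Ginv (G y + (y - ?P y)) = y"
      "\<And>y. G (Ginv y) + (Ginv y - ?P (Ginv y)) = y"
    and inv_der: "(inv_into UNIV grad_ext has_derivative Ginv) (at (grad_ext x0))"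
    and interior: "grad_ext x0 \<in> interior (range grad_ext)"
    using has_derivative_inv_at_image[OF continuous_on_grad_ext inj_grad_ext
        has_derivative_grad_ext[OF G] inj_deriv_grad_ext[OF x0 G]] by blast
  define v' where "v' h = G (?P h) - \<alpha> *\<^sub>R ?P (Hf h)" for h
  have arg_der: "(psi_arg f \<alpha> has_derivative v') (at xs)"
    unfolding v'_def[abs_def] G_def x0_def by (rule has_derivative_psi_arg[OF Hf])
  have arg_xs: "psi_arg f \<alpha> xs = grad_ext x0"
    by (simp add: psi_arg_def gf0 grad_ext_def x0_def)
  define D where "D h = h - ?P h + Ginv (v' h)" for h
  have "((\<lambda>x. x - ?P x + inv_into UNIV grad_ext (psi_arg f \<alpha> x)) has_derivative D) (at xs)"
  proof -
    have "((inv_into UNIV grad_ext \<circ> psi_arg f \<alpha>) has_derivative (Ginv \<circ> v')) (at xs)"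
      by (rule diff_chain_at[OF arg_der]) (simp add: arg_xs inv_der)
    then show ?thesis unfolding D_def[abs_def] o_def
      by (intro has_derivative_add has_derivative_diff has_derivative_ident has_derivative_blkproj)
  qed
  moreover have "\<forall>\<^sub>F x in at xs.
      x - ?P x + inv_into UNIV grad_ext (psi_arg f \<alpha> x) = psi_blk f \<phi> blk \<alpha> s x"
    by (rule eventually_psi_blk_eq_inv_grad_ext[OF has_derivative_continuous[OF arg_der]
          interior[folded arg_xs]])
  moreover have "xs - ?P xs + inv_into UNIV grad_ext (psi_arg f \<alpha> xs) = psi_blk f \<phi> blk \<alpha> s xs"
    by (simp add: psi_blk_fixed_point[OF gf0] arg_xs inv_into_f_f[OF inj_grad_ext] x0_def)
  ultimately have "(psi_blk f \<phi> blk \<alpha> s has_derivative D) (at xs)"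
    by (rule has_derivative_transform_eventually[OF _ _ _ UNIV_I])
  moreover have "\<exists>d\<in>blksub blk s. D h = h - d \<and> G d = \<alpha> *\<^sub>R ?P (Hf h)" for h
  proof -
    define w where "w = Ginv (?P (Hf h))"
    note w = inverse_deriv_grad_ext_blksub[OF x0 G Ginv(3) blkproj_in_blksub[of blk s "Hf h"],
        folded w_def]
    have "Ginv (G (?P h)) = ?P h" using Ginv(2)[of "?P h"] by simp
    then have "D h = h - \<alpha> *\<^sub>R w"
      by (simp add: D_def v'_def w_def linear_diff[OF Ginv(1)] linear_scale[OF Ginv(1)])
    moreover have "G (\<alpha> *\<^sub>R w) = \<alpha> *\<^sub>R ?P (Hf h)"
      using w(2) linear_scale[OF has_derivative_linear[OF G]] by simp
    moreover have "\<alpha> *\<^sub>R w \<in> blksub blk s" using w(1) subspace_blksub by (rule subspace_mul[rotated])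
    ultimately show ?thesis by blast
  qed
  ultimately show ?thesis using that unfolding G_def x0_def by blast
qed

lemma psi_blk_derivative_bounds:
  assumes Hf: "(grad f has_derivative Hf) (at xs)" and gf0: "grad f xs = 0" and \<alpha>: "\<alpha> > 0"
  obtains D B where "(psi_blk f \<phi> blk \<alpha> s has_derivative D) (at xs)" and "B \<ge> 0"
    and "\<And>h. \<exists>d. D h = h - d \<and> m * (norm d)\<^sup>2 \<le> \<alpha> * inner d (Hf h)
                 \<and> norm (blkproj blk s (Hf h)) \<le> B * norm d"
proof -
  let ?P = "blkproj blk s"
  define G where "G = frechet_derivative (grad (\<phi> s)) (at (?P xs))"
  have G: "(grad (\<phi> s) has_derivative G) (at (?P xs))"
    unfolding G_def by (rule has_derivative_grad_phi)
  have x0: "?P xs \<in> blksub blk s" by (rule blkproj_in_blksub)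
  obtain BG where BG: "BG \<ge> 0" "\<And>h. norm (G h) \<le> norm h * BG"
    using G has_derivative_bounded_linear bounded_linear.nonneg_bounded by blast
  obtain D where D: "(psi_blk f \<phi> blk \<alpha> s has_derivative D) (at xs)"
    and corr: "\<And>h. \<exists>d\<in>blksub blk s. D h = h - d \<and> G d = \<alpha> *\<^sub>R ?P (Hf h)"
    using psi_blk_linearisation[OF Hf gf0] unfolding G_def by blast
  have bounds: "\<exists>d. D h = h - d \<and> m * (norm d)\<^sup>2 \<le> \<alpha> * inner d (Hf h)
      \<and> norm (?P (Hf h)) \<le> (BG / \<alpha>) * norm d" for h
  proof -
    obtain d where d: "d \<in> blksub blk s" "D h = h - d" "G d = \<alpha> *\<^sub>R ?P (Hf h)"
      using corr by blast
    have "m * (norm d)\<^sup>2 \<le> inner (G d) d" by (rule deriv_grad_phi_coercive[OF x0 G d(1)])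
    also have "\<dots> = \<alpha> * inner d (Hf h)"
      using d by (simp add: inner_commute[of "?P (Hf h)" d] inner_blksub_blkproj)
    finally have "m * (norm d)\<^sup>2 \<le> \<alpha> * inner d (Hf h)" .
    moreover have "norm (?P (Hf h)) \<le> (BG / \<alpha>) * norm d"
    proof -
      have "\<alpha> * norm (?P (Hf h)) \<le> norm d * BG"
        using d(3) BG(2)[of d] \<alpha> by simp
      then show ?thesis using \<alpha> by (simp add: field_simps)
    qed
    ultimately show ?thesis using d(2) by blast
  qed
  have "BG / \<alpha> \<ge> 0" using BG \<alpha> by simp
  from that[OF D this bounds] show ?thesis .
qed

end

section \<open>A sweep of linearised block steps\<close>

primrec compose_upto :: "(nat \<Rightarrow> 'a \<Rightarrow> 'a) \<Rightarrow> nat \<Rightarrow> 'a \<Rightarrow> 'a" where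
  "compose_upto F 0 = id"
| "compose_upto F (Suc k) = F (Suc k) \<circ> compose_upto F k"

lemma psi_comp_eq_compose_upto: "psi_comp f \<phi> blk \<alpha> k = compose_upto (psi_blk f \<phi> blk \<alpha>) k"
  by (induction k) simp_all

lemma has_derivative_compose_upto:
  assumes "\<And>s. s \<in> {1..k} \<Longrightarrow> (F s has_derivative D s) (at x) \<and> F s x = x"
  shows "(compose_upto F k has_derivative compose_upto D k) (at x) \<and> compose_upto F k x = x"
  using assms
proof (induction k)
  case 0
  show ?case using has_derivative_ident by (simp add: id_def)
next
  case (Suc k)
  then have IH: "(compose_upto F k has_derivative compose_upto D k) (at x)" "compose_upto F k x = x"
    by auto
  have last: "(F (Suc k) has_derivative D (Suc k)) (at x)" "F (Suc k) x = x"
    using Suc.prems by auto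
  have "((F (Suc k) \<circ> compose_upto F k) has_derivative (D (Suc k) \<circ> compose_upto D k)) (at x)"
    by (rule diff_chain_at[OF IH(1)]) (simp add: IH(2) last(1))
  then show ?case using IH(2) last(2) by (simp add: comp_def)
qed

lemma power2_add_le: "(a + b)\<^sup>2 \<le> 2 * a\<^sup>2 + 2 * (b::real)\<^sup>2"
  using sum_squares_bound[of a b] by (simp add: power2_sum)

lemma quadratic_form_correction_le:
  fixes H :: "'a::real_inner \<Rightarrow> 'a"
  assumes lin: "linear H" and sym: "\<And>x y. inner x (H y) = inner (H x) y"
    and bnd: "\<And>x. norm (H x) \<le> L * norm x"
    and \<alpha>: "\<alpha> > 0" and \<alpha>L: "\<alpha> * L \<le> \<mu>"
    and d: "\<mu> * (norm d)\<^sup>2 \<le> \<alpha> * inner d (H h)"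
  shows "inner (h - d) (H (h - d)) \<le> inner h (H h) - \<mu> / \<alpha> * (norm d)\<^sup>2"
proof -
  have expand: "inner (h - d) (H (h - d)) = inner h (H h) - 2 * inner d (H h) + inner d (H d)"
    using sym[of h d] linear_diff[OF lin, of h d]
    by (simp add: inner_diff_left inner_diff_right inner_commute[of "H h" d])
  have "inner d (H d) \<le> norm d * norm (H d)" using Cauchy_Schwarz_ineq2[of d "H d"] by linarith
  also have "\<dots> \<le> norm d * (L * norm d)" by (intro mult_left_mono bnd) auto
  finally have "inner d (H d) \<le> L * (norm d)\<^sup>2" by (simp add: power2_eq_square mult_ac)
  moreover have "\<mu> / \<alpha> * (norm d)\<^sup>2 \<le> inner d (H h)" using d \<alpha> by (simp add: field_simps)
  moreover have "L * (norm d)\<^sup>2 \<le> \<mu> / \<alpha> * (norm d)\<^sup>2"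
    using \<alpha>L \<alpha> by (intro mult_right_mono) (auto simp: field_simps)
  ultimately show ?thesis using expand by linarith
qed

lemma neg_quadratic_form_le_norm_image:
  fixes H :: "'a::euclidean_space \<Rightarrow> 'a"
  assumes lin: "linear H" and sym: "\<And>x y. inner x (H y) = inner (H x) y"
  obtains K where "K > 0" and "\<And>h. - inner h (H h) \<le> K * (norm (H h))\<^sup>2"
proof -
  let ?S = "range H"
  have sub: "Real_Vector_Spaces.subspace ?S" using linear_subspace_image[OF lin subspace_UNIV] by simp
  have inj: "\<forall>x\<in>?S. H x = 0 \<longrightarrow> x = 0"
  proof (intro ballI impI)
    fix x assume "x \<in> ?S" "H x = 0"
    then obtain z where z: "x = H z" by auto
    have "inner x x = inner z (H x)" using sym[of z x] z by (simp add: inner_commute)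
    then show "x = 0" using \<open>H x = 0\<close> by simp
  qed
  obtain e where e: "e > 0" "\<And>x. x \<in> ?S \<Longrightarrow> e * norm x \<le> norm (H x)"
    using injective_imp_isometric[OF closed_subspace[OF sub] sub
        linear_conv_bounded_linear[THEN iffD1, OF lin] inj] by blast
  have "- inner h (H h) \<le> 1 / e * (norm (H h))\<^sup>2" for h
  proof -
    obtain y z where y: "y \<in> span ?S" and z: "\<And>w. w \<in> span ?S \<Longrightarrow> Linear_Algebra.orthogonal z w"
      and hyz: "h = y + z"
      using orthogonal_subspace_decomp_exists by blast
    have yS: "y \<in> ?S" using y sub by (metis span_eq_iff)
    have "Linear_Algebra.orthogonal z (H (H z))" using z by (simp add: span_base)
    then have "inner (H z) (H z) = 0" using sym[of z "H z"] by (simp add: Linear_Algebra.orthogonal_def)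
    then have Hz: "H z = 0" by simp
    have Hh: "H h = H y" using hyz Hz linear_add[OF lin] by simp
    have "Linear_Algebra.orthogonal z (H y)" using z by (simp add: span_base)
    then have "inner h (H h) = inner y (H y)"
      using Hh hyz by (simp add: inner_add_left Linear_Algebra.orthogonal_def)
    moreover have "- inner y (H y) \<le> norm y * norm (H y)"
      using Cauchy_Schwarz_ineq2[of y "H y"] by linarith
    moreover have "norm y * norm (H y) \<le> norm (H y) / e * norm (H y)"
      using e(2)[OF yS] e(1) by (intro mult_right_mono) (auto simp: field_simps)
    ultimately show ?thesis using Hh by (simp add: power2_eq_square)
  qed
  then show ?thesis using e(1) that[of "1 / e"] by simp
qed

text \<open>\<open>D s\<close> is the Jacobian of the \<open>s\<close>-th block map and \<open>H\<close> the Hessian of \<open>f\<close>, both at the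
  saddle point; \<open>- inner h (H h)\<close> is the quantity that grows along a sweep.\<close>

locale block_sweep =
  fixes H :: "real^'n \<Rightarrow> real^'n" and L \<mu> \<alpha> :: real and blk :: "'n \<Rightarrow> nat" and p :: nat
    and D :: "nat \<Rightarrow> real^'n \<Rightarrow> real^'n" and K :: "nat \<Rightarrow> real"
  assumes linear_H: "linear H"
    and symmetric_H: "\<And>x y. inner x (H y) = inner (H x) y"
    and norm_H_le: "\<And>x. norm (H x) \<le> L * norm x"
    and alpha_pos: "\<alpha> > 0" and mu_pos: "\<mu> > 0" and alpha_L_le: "\<alpha> * L \<le> \<mu>"
    and blk_range: "\<And>i. blk i \<in> {1..p}"
    and K_nonneg: "\<And>s. s \<in> {1..p} \<Longrightarrow> K s \<ge> 0"
    and block_step: "\<And>s h. s \<in> {1..p} \<Longrightarrow> \<exists>d. D s h = h - d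
        \<and> \<mu> * (norm d)\<^sup>2 \<le> \<alpha> * inner d (H h) \<and> norm (blkproj blk s (H h)) \<le> K s * norm d"
begin

lemma L_nonneg: "L \<ge> 0"
  using norm_H_le[of "axis undefined 1"]
  by (metis norm_axis_1 norm_ge_zero order_trans mult.right_neutral)

lemma neg_quadratic_form_le: "- inner x (H x) \<le> L * (norm x)\<^sup>2"
proof -
  have "- inner x (H x) \<le> norm x * norm (H x)" using Cauchy_Schwarz_ineq2[of x "H x"] by linarith
  also have "\<dots> \<le> norm x * (L * norm x)" by (intro mult_left_mono norm_H_le) auto
  finally show ?thesis by (simp add: power2_eq_square mult_ac)
qed

text \<open>One more block step, with \<open>h'\<close> the image of \<open>h\<close> under the earlier steps and \<open>E\<close> the
  accumulated squared size of their corrections.\<close>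

lemma sweep_invariant_step:
  assumes E: "E \<ge> 0" and M: "M \<ge> 0" and B: "B \<ge> 0"
    and q: "inner h' (H h') \<le> inner h (H h) - \<mu> / \<alpha> * E"
    and dist: "(norm (h - h'))\<^sup>2 \<le> M * E"
    and d: "\<mu> * (norm d)\<^sup>2 \<le> \<alpha> * inner d (H h')"
    and res: "norm (blkproj blk s (H h')) \<le> B * norm d"
  shows "inner (h' - d) (H (h' - d)) \<le> inner h (H h) - \<mu> / \<alpha> * (E + (norm d)\<^sup>2)"
    and "(norm (h - (h' - d)))\<^sup>2 \<le> (2 * M + 2) * (E + (norm d)\<^sup>2)"
    and "(norm (blkproj blk s (H h)))\<^sup>2 \<le> (2 * B\<^sup>2 + 2 * L\<^sup>2 * M) * (E + (norm d)\<^sup>2)"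
proof -
  show "inner (h' - d) (H (h' - d)) \<le> inner h (H h) - \<mu> / \<alpha> * (E + (norm d)\<^sup>2)"
    using quadratic_form_correction_le[OF linear_H symmetric_H norm_H_le alpha_pos alpha_L_le d] q
    by (simp add: algebra_simps)
  have "norm (h - (h' - d)) \<le> norm (h - h') + norm d"
    using norm_triangle_ineq[of "h - h'" d] by (simp add: algebra_simps)
  then have "(norm (h - (h' - d)))\<^sup>2 \<le> (norm (h - h') + norm d)\<^sup>2"
    by (intro power_mono) auto
  also have "\<dots> \<le> 2 * (norm (h - h'))\<^sup>2 + 2 * (norm d)\<^sup>2" by (rule power2_add_le)
  also have "\<dots> \<le> (2 * M + 2) * (E + (norm d)\<^sup>2)"
    using dist E mult_nonneg_nonneg[OF M zero_le_power2[of "norm d"]] by (simp add: algebra_simps)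
  finally show "(norm (h - (h' - d)))\<^sup>2 \<le> (2 * M + 2) * (E + (norm d)\<^sup>2)" .
  have "blkproj blk s (H h) = blkproj blk s (H h') + blkproj blk s (H (h - h'))"
    using linear_diff[OF linear_H, of h h'] by (simp flip: blkproj_add)
  then have "norm (blkproj blk s (H h))
      \<le> norm (blkproj blk s (H h')) + norm (blkproj blk s (H (h - h')))"
    by (metis norm_triangle_ineq)
  then have "norm (blkproj blk s (H h)) \<le> B * norm d + L * norm (h - h')"
    using norm_blkproj_le[of blk s "H (h - h')"] norm_H_le[of "h - h'"] res by linarith
  then have "(norm (blkproj blk s (H h)))\<^sup>2 \<le> (B * norm d + L * norm (h - h'))\<^sup>2"
    by (intro power_mono) auto
  also have "\<dots> \<le> 2 * B\<^sup>2 * (norm d)\<^sup>2 + 2 * L\<^sup>2 * (norm (h - h'))\<^sup>2"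
    using power2_add_le[of "B * norm d" "L * norm (h - h')"] by (simp add: power_mult_distrib)
  also have "\<dots> \<le> (2 * B\<^sup>2 + 2 * L\<^sup>2 * M) * (E + (norm d)\<^sup>2)"
    using mult_left_mono[OF dist, of "2 * L\<^sup>2"] mult_nonneg_nonneg[OF zero_le_power2[of B] E]
      mult_nonneg_nonneg[OF mult_nonneg_nonneg[OF zero_le_power2[of L] M] zero_le_power2[of "norm d"]]
    by (simp add: algebra_simps)
  finally show "(norm (blkproj blk s (H h)))\<^sup>2 \<le> (2 * B\<^sup>2 + 2 * L\<^sup>2 * M) * (E + (norm d)\<^sup>2)" .
qed

lemma sweep_invariant:
  "k \<le> p \<Longrightarrow> \<exists>M N. M \<ge> 0 \<and> N \<ge> 0 \<and> (\<forall>h. \<exists>E\<ge>0.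
      inner (compose_upto D k h) (H (compose_upto D k h)) \<le> inner h (H h) - \<mu> / \<alpha> * E
      \<and> (norm (h - compose_upto D k h))\<^sup>2 \<le> M * E
      \<and> (\<forall>s\<in>{1..k}. (norm (blkproj blk s (H h)))\<^sup>2 \<le> N * E))"
proof (induction k)
  case 0
  show ?case by (intro exI[of _ 0]) (auto intro!: exI[of _ 0])
next
  case (Suc k)
  then obtain M N where M: "M \<ge> 0" and N: "N \<ge> 0" and IH: "\<And>h. \<exists>E\<ge>0.
      inner (compose_upto D k h) (H (compose_upto D k h)) \<le> inner h (H h) - \<mu> / \<alpha> * E
      \<and> (norm (h - compose_upto D k h))\<^sup>2 \<le> M * E
      \<and> (\<forall>s\<in>{1..k}. (norm (blkproj blk s (H h)))\<^sup>2 \<le> N * E)" by auto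
  have sk: "Suc k \<in> {1..p}" using Suc.prems by auto
  define N' where "N' = max N (2 * (K (Suc k))\<^sup>2 + 2 * L\<^sup>2 * M)"
  have "\<exists>E\<ge>0.
      inner (compose_upto D (Suc k) h) (H (compose_upto D (Suc k) h)) \<le> inner h (H h) - \<mu> / \<alpha> * E
      \<and> (norm (h - compose_upto D (Suc k) h))\<^sup>2 \<le> (2 * M + 2) * E
      \<and> (\<forall>s\<in>{1..Suc k}. (norm (blkproj blk s (H h)))\<^sup>2 \<le> N' * E)" for h
  proof -
    obtain E where E: "E \<ge> 0"
      and q: "inner (compose_upto D k h) (H (compose_upto D k h)) \<le> inner h (H h) - \<mu> / \<alpha> * E"
      and dist: "(norm (h - compose_upto D k h))\<^sup>2 \<le> M * E"
      and earlier: "\<And>s. s \<in> {1..k} \<Longrightarrow> (norm (blkproj blk s (H h)))\<^sup>2 \<le> N * E"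
      using IH[of h] by auto
    obtain d where step: "D (Suc k) (compose_upto D k h) = compose_upto D k h - d"
      and d: "\<mu> * (norm d)\<^sup>2 \<le> \<alpha> * inner d (H (compose_upto D k h))"
      and res: "norm (blkproj blk (Suc k) (H (compose_upto D k h))) \<le> K (Suc k) * norm d"
      using block_step[OF sk] by blast
    note new = sweep_invariant_step[OF E M K_nonneg[OF sk] q dist d res]
    have E': "E \<le> E + (norm d)\<^sup>2" by simp
    have "(norm (blkproj blk s (H h)))\<^sup>2 \<le> N' * (E + (norm d)\<^sup>2)" if s: "s \<in> {1..Suc k}" for s
    proof (cases "s = Suc k")
      case True
      have "2 * (K (Suc k))\<^sup>2 + 2 * L\<^sup>2 * M \<le> N'" by (simp add: N'_def)
      then show ?thesis using new(3) True E by (meson mult_right_mono order_trans zero_le_power2 add_nonneg_nonneg)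
    next
      case False
      then have "(norm (blkproj blk s (H h)))\<^sup>2 \<le> N * E" using s earlier by auto
      also have "\<dots> \<le> N' * (E + (norm d)\<^sup>2)" using E N E' by (intro mult_mono) (auto simp: N'_def)
      finally show ?thesis .
    qed
    then show ?thesis using new(1,2) step E by (intro exI[of _ "E + (norm d)\<^sup>2"]) auto
  qed
  moreover have "2 * M + 2 \<ge> 0" "N' \<ge> 0" using M N by (auto simp: N'_def)
  ultimately show ?case by blast
qed

lemma sweep_expands:
  obtains \<delta> where "\<delta> > 0" and "\<And>h. inner h (H h) \<le> 0 \<Longrightarrow>
      (1 + \<delta>) * (- inner h (H h)) \<le> - inner (compose_upto D p h) (H (compose_upto D p h))"
proof -
  obtain M N where N: "N \<ge> 0" and inv: "\<And>h. \<exists>E\<ge>0.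
      inner (compose_upto D p h) (H (compose_upto D p h)) \<le> inner h (H h) - \<mu> / \<alpha> * E
      \<and> (\<forall>s\<in>{1..p}. (norm (blkproj blk s (H h)))\<^sup>2 \<le> N * E)"
    using sweep_invariant[of p] by blast
  obtain C where C: "C > 0" "\<And>h. - inner h (H h) \<le> C * (norm (H h))\<^sup>2"
    using neg_quadratic_form_le_norm_image[OF linear_H symmetric_H] by blast
  have p: "p \<ge> 1" using blk_range[of undefined] by auto
  define \<delta> where "\<delta> = \<mu> / \<alpha> / (C * (real p)\<^sup>2 * (N + 1))"
  have \<delta>: "\<delta> > 0" using alpha_pos mu_pos C N p by (simp add: \<delta>_def)
  have "(1 + \<delta>) * (- inner h (H h)) \<le> - inner (compose_upto D p h) (H (compose_upto D p h))"
    if "inner h (H h) \<le> 0" for h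
  proof -
    obtain E where E: "E \<ge> 0"
      and q: "inner (compose_upto D p h) (H (compose_upto D p h)) \<le> inner h (H h) - \<mu> / \<alpha> * E"
      and blocks: "\<And>s. s \<in> {1..p} \<Longrightarrow> (norm (blkproj blk s (H h)))\<^sup>2 \<le> N * E"
      using inv[of h] by blast
    have block_le: "norm (blkproj blk s (H h)) \<le> sqrt ((N + 1) * E)" if "s \<in> {1..p}" for s
      using blocks[OF that] E by (simp add: real_le_rsqrt algebra_simps)
    have "norm (H h) = norm (\<Sum>s\<in>{1..p}. blkproj blk s (H h))"
      by (simp only: sum_blkproj[OF blk_range])
    also have "\<dots> \<le> (\<Sum>s\<in>{1..p}. norm (blkproj blk s (H h)))" by (rule norm_sum)
    also have "\<dots> \<le> (\<Sum>s\<in>{1..p}. sqrt ((N + 1) * E))" by (intro sum_mono block_le)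
    also have "\<dots> = real p * sqrt ((N + 1) * E)" by simp
    finally have "(norm (H h))\<^sup>2 \<le> (real p * sqrt ((N + 1) * E))\<^sup>2" by (intro power_mono) auto
    also have "\<dots> = (real p)\<^sup>2 * (N + 1) * E" using N E by (simp add: power_mult_distrib)
    finally have "- inner h (H h) \<le> C * ((real p)\<^sup>2 * (N + 1) * E)"
      using C by (meson mult_left_mono less_imp_le order_trans)
    then have "\<delta> * (- inner h (H h)) \<le> \<delta> * (C * ((real p)\<^sup>2 * (N + 1) * E))"
      using \<delta> by (intro mult_left_mono) auto
    also have "\<dots> = \<mu> / \<alpha> * E" using C N p by (simp add: \<delta>_def)
    finally show ?thesis using q by (simp add: algebra_simps)
  qed
  with \<delta> that show ?thesis by blast
qed

lemma complex_eigenvalue_gt_1: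
  assumes lin: "linear (compose_upto D p)"
    and ev: "H v = l *\<^sub>R v" and v: "v \<noteq> 0" and l: "l < 0"
  shows "\<exists>z. complex_eigenvalue (matrix (compose_upto D p)) z \<and> cmod z > 1"
proof -
  let ?C = "compose_upto D p"
  obtain \<delta> where \<delta>: "\<delta> > 0" and expands: "\<And>h. inner h (H h) \<le> 0 \<Longrightarrow>
      (1 + \<delta>) * (- inner h (H h)) \<le> - inner (?C h) (H (?C h))"
    using sweep_expands by blast
  define a where "a = - inner v (H v)"
  have a: "a > 0" using ev v l by (simp add: a_def mult_neg_pos)
  have grow: "(1 + \<delta>) ^ k * a \<le> - inner ((?C ^^ k) v) (H ((?C ^^ k) v))" for k
  proof (induction k)
    case 0
    show ?case by (simp add: a_def)
  next
    case (Suc k)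
    have "0 \<le> (1 + \<delta>) ^ k * a" using \<delta> a by simp
    then have "inner ((?C ^^ k) v) (H ((?C ^^ k) v)) \<le> 0" using Suc by linarith
    from expands[OF this] have "(1 + \<delta>) * (- inner ((?C ^^ k) v) (H ((?C ^^ k) v)))
        \<le> - inner ((?C ^^ Suc k) v) (H ((?C ^^ Suc k) v))" by simp
    moreover have "(1 + \<delta>) * ((1 + \<delta>) ^ k * a) \<le> (1 + \<delta>) * (- inner ((?C ^^ k) v) (H ((?C ^^ k) v)))"
      using Suc.IH \<delta> by (intro mult_left_mono) auto
    ultimately show ?case by (simp add: mult.assoc)
  qed
  have L: "L > 0"
    using neg_quadratic_form_le[of v] a L_nonneg v unfolding a_def
    by (metis less_le_trans mult_eq_0_iff order_less_le zero_less_power2 norm_eq_zero)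
  have "sqrt (a / L) * sqrt (1 + \<delta>) ^ k \<le> norm (((*v) (matrix ?C) ^^ k) v)" for k
  proof -
    have "(1 + \<delta>) ^ k * a \<le> L * (norm ((?C ^^ k) v))\<^sup>2"
      using grow[of k] neg_quadratic_form_le[of "(?C ^^ k) v"] by linarith
    then have "(1 + \<delta>) ^ k * (a / L) \<le> (norm ((?C ^^ k) v))\<^sup>2" using L by (simp add: field_simps)
    then have "sqrt ((1 + \<delta>) ^ k * (a / L)) \<le> norm ((?C ^^ k) v)"
      by (simp add: real_le_lsqrt)
    moreover have "sqrt (a / L) * sqrt (1 + \<delta>) ^ k = sqrt ((1 + \<delta>) ^ k * (a / L))"
      by (simp only: real_sqrt_mult real_sqrt_power mult.commute)
    moreover have "(*v) (matrix ?C) = ?C" using lin by (simp add: matrix_works[symmetric] fun_eq_iff)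
    ultimately show ?thesis by simp
  qed
  moreover have "sqrt (1 + \<delta>) > 1" "sqrt (a / L) > 0" using \<delta> a L by simp_all
  ultimately show ?thesis using complex_eigenvalue_gt_1_if_exponential_growth by blast
qed

end

section \<open>The Jacobian of a sweep at a strict saddle point\<close>

lemma strict_saddle_negative_eigenvector:
  assumes "strict_saddle f x" and Hf: "(grad f has_derivative Hf) (at x)"
  obtains v l where "v \<noteq> 0" and "l < 0" and "Hf v = l *\<^sub>R v"
proof -
  obtain l v where "l < 0" "v \<noteq> 0" "hessian f x *v v = l *\<^sub>R v"
    using assms(1) unfolding strict_saddle_def real_eigenvalue_def by blast
  moreover have "hessian f x *v v = Hf v"
    using matrix_works[OF linear_matrix_vector_mul_eq[THEN iffD2, OF has_derivative_linear[OF Hf]]]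
      frechet_derivative_at[OF Hf]
    by (simp add: hessian_def)
  ultimately show ?thesis using that by auto
qed

lemma block_sweep_at_critical_point:
  assumes block: "\<And>s x. s \<in> {1..p} \<Longrightarrow> \<phi> s x = \<phi> s (blkproj blk s x)"
    and C2: "\<And>s. s \<in> {1..p} \<Longrightarrow> C2 (\<phi> s)"
    and sc: "\<And>s. s \<in> {1..p} \<Longrightarrow> strongly_convex_grad_on (blksub blk s) \<mu> (\<phi> s)"
    and \<mu>: "\<mu> > 0" and \<alpha>: "\<alpha> > 0" and \<alpha>L: "\<alpha> * L \<le> \<mu>" and blk_range: "\<And>i. blk i \<in> {1..p}"
    and f_diff: "\<And>x. f differentiable (at x)"
    and f_lip: "\<And>x y. norm (grad f x - grad f y) \<le> L * norm (x - y)"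
    and Hf: "(grad f has_derivative Hf) (at xs)" and gf0: "grad f xs = 0"
  obtains D K where "block_sweep Hf L \<mu> \<alpha> blk p D K"
    and "\<And>s. s \<in> {1..p} \<Longrightarrow>
      psi_blk f \<phi> blk \<alpha> s xs = xs \<and> (psi_blk f \<phi> blk \<alpha> s has_derivative D s) (at xs)"
proof -
  have "\<exists>D B. psi_blk f \<phi> blk \<alpha> s xs = xs \<and> (psi_blk f \<phi> blk \<alpha> s has_derivative D) (at xs)
    \<and> B \<ge> 0 \<and> (\<forall>h. \<exists>d. D h = h - d \<and> \<mu> * (norm d)\<^sup>2 \<le> \<alpha> * inner d (Hf h)
                     \<and> norm (blkproj blk s (Hf h)) \<le> B * norm d)" if s: "s \<in> {1..p}" for s
  proof -
    interpret block_potential blk s \<phi> \<mu>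
      using block[OF s] C2[OF s] sc[OF s] \<mu> by unfold_locales (auto simp: C2_def)
    show ?thesis using psi_blk_fixed_point[OF gf0] psi_blk_derivative_bounds[OF Hf gf0 \<alpha>] by metis
  qed
  then obtain D K where blocks: "\<And>s. s \<in> {1..p} \<Longrightarrow> psi_blk f \<phi> blk \<alpha> s xs = xs
    \<and> (psi_blk f \<phi> blk \<alpha> s has_derivative D s) (at xs) \<and> K s \<ge> 0
    \<and> (\<forall>h. \<exists>d. D s h = h - d \<and> \<mu> * (norm d)\<^sup>2 \<le> \<alpha> * inner d (Hf h)
             \<and> norm (blkproj blk s (Hf h)) \<le> K s * norm d)"
    by metis
  have "block_sweep Hf L \<mu> \<alpha> blk p D K"
    by (rule block_sweep.intro[OF has_derivative_linear[OF Hf] derivative_grad_symmetric[OF f_diff Hf]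
          norm_derivative_le_if_Lipschitz[OF Hf f_lip] \<alpha> \<mu> \<alpha>L blk_range])
      (use blocks in blast)+
  with blocks that show ?thesis by blast
qed

theorem proposition6:
  fixes f :: "real^'n \<Rightarrow> real" and L :: real
    and p :: nat and blk :: "'n \<Rightarrow> nat"
    and \<phi> :: "nat \<Rightarrow> real^'n \<Rightarrow> real" and \<mu> :: "nat \<Rightarrow> real"
    and \<alpha> :: real and xs :: "real^'n"
  assumes blk_range: "\<And>i. blk i \<in> {1..p}"
    and blk_nonempty: "\<And>s. s \<in> {1..p} \<Longrightarrow> \<exists>i. blk i = s"
    and f_C2: "C2 f"
    and L_pos: "L > 0"
    and f_lip: "\<And>x y. norm (grad f x - grad f y) \<le> L * norm (x - y)"
    and \<phi>_block: "\<And>s x. s \<in> {1..p} \<Longrightarrow> \<phi> s x = \<phi> s (blkproj blk s x)"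
    and \<phi>_C2: "\<And>s. s \<in> {1..p} \<Longrightarrow> C2 (\<phi> s)"
    and \<mu>_pos: "\<And>s. s \<in> {1..p} \<Longrightarrow> \<mu> s > 0"
    and \<phi>_sc: "\<And>s. s \<in> {1..p} \<Longrightarrow> strongly_convex_grad_on (blksub blk s) (\<mu> s) (\<phi> s)"
    and \<alpha>_pos: "\<alpha> > 0"
    and \<alpha>_bound: "\<alpha> < Min (\<mu> ` {1..p}) / L"
    and saddle: "strict_saddle f xs"
  shows "psi_comp f \<phi> blk \<alpha> p differentiable (at xs) \<and>
         (\<exists>l. complex_eigenvalue (matrix (frechet_derivative (psi_comp f \<phi> blk \<alpha> p) (at xs))) l
              \<and> cmod l > 1)"
proof -
  have f_diff: "\<And>x. f differentiable (at x)" and "grad f differentiable (at xs)"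
    using f_C2 by (auto simp: C2_def)
  then obtain Hf where Hf: "(grad f has_derivative Hf) (at xs)" by (auto simp: differentiable_def)
  obtain v l where v: "v \<noteq> 0" "l < 0" "Hf v = l *\<^sub>R v"
    using strict_saddle_negative_eigenvector[OF saddle Hf] by blast
  have gf0: "grad f xs = 0" using saddle by (simp add: strict_saddle_def)
  define \<mu>m where "\<mu>m = Min (\<mu> ` {1..p})"
  have "\<mu> ` {1..p} \<noteq> {}" using blk_range[of undefined] by auto
  then have \<mu>m: "\<mu>m > 0" "\<alpha> * L \<le> \<mu>m" "\<And>s. s \<in> {1..p} \<Longrightarrow> \<mu>m \<le> \<mu> s"
    using Min_in[of "\<mu> ` {1..p}"] \<mu>_pos \<alpha>_bound L_pos
    by (auto simp: \<mu>m_def pos_less_divide_eq)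
  obtain D K where "block_sweep Hf L \<mu>m \<alpha> blk p D K"
    and blocks: "\<And>s. s \<in> {1..p} \<Longrightarrow>
      psi_blk f \<phi> blk \<alpha> s xs = xs \<and> (psi_blk f \<phi> blk \<alpha> s has_derivative D s) (at xs)"
    using block_sweep_at_critical_point[OF \<phi>_block \<phi>_C2 strongly_convex_grad_on_mono[OF \<phi>_sc \<mu>m(3)]
        \<mu>m(1) \<alpha>_pos \<mu>m(2) blk_range f_diff f_lip Hf gf0] by blast
  then interpret block_sweep Hf L \<mu>m \<alpha> blk p D K by simp
  have der: "(psi_comp f \<phi> blk \<alpha> p has_derivative compose_upto D p) (at xs)"
    using has_derivative_compose_upto[of p "psi_blk f \<phi> blk \<alpha>" D xs] blocks
    by (simp add: psi_comp_eq_compose_upto)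
  show ?thesis
    using complex_eigenvalue_gt_1[OF has_derivative_linear[OF der] v(3,1,2)]
      frechet_derivative_at[OF der] der by (auto simp: differentiable_def)
qed

end
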